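(* Fix $\alpha,\beta>-1$. Let $\theta_j^{(n)}$, $j=1,2,\dots,n$, be defined by $$0<\theta_1^{(n)}<\cdots<\theta_n^{(n)}<\pi$$ and the requirement that $x_j^{(n)}=\cos(\theta_j^{(n)})$, $j=1,\dots,n$, are all the zeros of the Jacobi polynomial $P_n^{(\alpha,\beta)}(x)$. Then for each $\varepsilon>0$, $$\sup_{j;\,\theta_j^{(n)}\in[\varepsilon,\pi-\varepsilon]}\, n\left|\theta_{j+1}^{(n)}-\theta_j^{(n)}-\frac{\pi}{n}\right|\to0\quad\text{as } n\to\infty.$$
   Context: The Jacobi polynomials $P_n^{(\alpha,\beta)}(x)$, $\alpha,\beta>-1$, are the degree-$n$ polynomials orthogonal with respect to the weight $w(x)=(1-x)^\alpha(1+x)^\beta$ on $[-1,1]$ (their normalization does not affect the zeros). *)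

theory Defs
  imports "HOL-Analysis.Analysis" "HOL-Computational_Algebra.Polynomial"
begin

definition jacobi_weight :: "real \<Rightarrow> real \<Rightarrow> real \<Rightarrow> real" where
  "jacobi_weight \<alpha> \<beta> x = (1 - x) powr \<alpha> * (1 + x) powr \<beta>"

(* The normalization is left open, so this determines each P n up to a nonzero constant factor
   (for \<alpha>, \<beta> > -1).  P n \<noteq> 0 only matters for n = 0, since degree 0 = 0.
   At x = 1 and x = -1 the weight is 0 by the convention 0 powr a = 0; this is a null set. *)
definition jacobi_polynomials :: "real \<Rightarrow> real \<Rightarrow> (nat \<Rightarrow> real poly) \<Rightarrow> bool" where
  "jacobi_polynomials \<alpha> \<beta> P \<longleftrightarrow>
     (\<forall>n. P n \<noteq> 0 \<and> degree (P n) = n) \<and>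
     (\<forall>m n. m \<noteq> n \<longrightarrow>
       ((\<lambda>x. poly (P m) x * poly (P n) x * jacobi_weight \<alpha> \<beta> x) has_integral 0) {-1..1})"

end

theory Submission
  imports Defs "HOL-Real_Asymp.Real_Asymp"
begin

text \<open>
  The Jacobi operator is symmetric for the Jacobi weight and does not raise the degree, so orthogonality
  alone makes \<open>P n\<close> an eigenfunction with eigenvalue \<open>- n (n + \<alpha> + \<beta> + 1)\<close>. Substituting
  \<open>x = cos t\<close> and removing the first-order term turns this into \<open>u'' + (l n - V t) u = 0\<close>, where
  \<open>l n \<sim> n\<^sup>2\<close> and \<open>V\<close> does not depend on \<open>n\<close> and is bounded on compact subintervals of \<open>(0, \<pi>)\<close>.
  Sturm comparison with sines of frequencies \<open>sqrt (l n \<plusminus> C)\<close> then traps the gap between consecutive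
  zeros between \<open>\<pi> / sqrt (l n + C)\<close> and \<open>\<pi> / sqrt (l n - C)\<close>.
\<close>

section \<open>The Jacobi differential equation from orthogonality\<close>

definition jacobi_operator :: "real \<Rightarrow> real \<Rightarrow> real poly \<Rightarrow> real poly" where
  "jacobi_operator \<alpha> \<beta> p =
     [:1, 0, -1:] * pderiv (pderiv p) + [:\<beta> - \<alpha>, -(\<alpha> + \<beta> + 2):] * pderiv p"

text \<open>In the monomial basis the operator is upper triangular: coefficient \<open>i\<close> of
  the image involves only the coefficients \<open>i\<close>, \<open>i + 1\<close>,
  \<open>i + 2\<close> of \<open>p\<close>. The diagonal entries are the eigenvalues.\<close>

lemma coeff_jacobi_operator:
  "coeff (jacobi_operator \<alpha> \<beta> p) i =
     (real i + 2) * (real i + 1) * coeff p (i + 2) + (\<beta> - \<alpha>) * (real i + 1) * coeff p (i + 1)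
     - real i * (real i + \<alpha> + \<beta> + 1) * coeff p i"
proof -
  consider "i = 0" | "i = 1" | k where "i = Suc (Suc k)"
    by (metis One_nat_def not0_implies_Suc)
  then show ?thesis
    by cases (simp_all add: jacobi_operator_def coeff_pderiv coeff_pCons algebra_simps)
qed

lemma poly_jacobi_operator:
  "poly (jacobi_operator \<alpha> \<beta> p) x = (1 - x\<^sup>2) * poly (pderiv (pderiv p)) x
     + (\<beta> - \<alpha> - (\<alpha> + \<beta> + 2) * x) * poly (pderiv p) x"
  by (simp add: jacobi_operator_def algebra_simps power2_eq_square)

text \<open>Lagrange's identity: for the weight \<open>w\<close> the operator is
  \<open>((1 - x^2) w p')' / w\<close>, so the integrand is the derivative of
  \<open>G = (1 - x^2) w (p' q - p q')\<close>, which vanishes at both endpoints.\<close>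

lemma jacobi_operator_symmetric:
  assumes "\<alpha> > -1" and "\<beta> > -1"
  shows "((\<lambda>x. (poly (jacobi_operator \<alpha> \<beta> p) x * poly q x - poly p x * poly (jacobi_operator \<alpha> \<beta> q) x)
            * jacobi_weight \<alpha> \<beta> x) has_integral 0) {-1..1}"
proof -
  define v where "v = (\<lambda>x. poly (pderiv p * q - p * pderiv q) x)"
  define G where "G = (\<lambda>x. (1 - x) powr (\<alpha> + 1) * (1 + x) powr (\<beta> + 1) * v x)"
  have "((\<lambda>x. (poly (jacobi_operator \<alpha> \<beta> p) x * poly q x - poly p x * poly (jacobi_operator \<alpha> \<beta> q) x)
            * jacobi_weight \<alpha> \<beta> x) has_integral G 1 - G (-1)) {-1..1}"
  \<comment> \<open>\<open>G\<close> may fail to be differentiable at the endpoints, but it is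
    continuous there because \<alpha> + 1 and \<beta> + 1 are positive.\<close>
  proof (rule fundamental_theorem_of_calculus_interior)
    have c: "continuous_on {-1..1} (\<lambda>x. (1 - x) powr (\<alpha> + 1))" "continuous_on {-1..1} (\<lambda>x. (1 + x) powr (\<beta> + 1))"
      using assms by (intro continuous_on_powr' continuous_on_diff continuous_on_add continuous_on_const
          continuous_on_id; simp)+
    show "continuous_on {-1..1} G"
      unfolding G_def v_def by (intro continuous_on_mult c continuous_on_poly continuous_on_id)
    fix x :: real assume x: "x \<in> {-1<..<1}"
    have pw: "(1 - x) powr (\<alpha> + 1) = (1 - x) * (1 - x) powr \<alpha>" "(1 + x) powr (\<beta> + 1) = (1 + x) * (1 + x) powr \<beta>"
      using x by (simp_all add: powr_add)
    have "pderiv (pderiv p * q - p * pderiv q) = pderiv (pderiv p) * q - p * pderiv (pderiv q)"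
      by (simp add: pderiv_diff pderiv_mult algebra_simps)
    then have dv: "(v has_real_derivative poly (pderiv (pderiv p) * q - p * pderiv (pderiv q)) x) (at x)"
      unfolding v_def by (metis poly_DERIV)
    have d1: "((\<lambda>x. (1 - x) powr (\<alpha> + 1)) has_real_derivative - ((\<alpha> + 1) * (1 - x) powr \<alpha>)) (at x)"
      using x by (auto intro!: derivative_eq_intros)
    have d2: "((\<lambda>x. (1 + x) powr (\<beta> + 1)) has_real_derivative (\<beta> + 1) * (1 + x) powr \<beta>) (at x)"
      using x by (auto intro!: derivative_eq_intros)
    have "(G has_real_derivative
        (poly (jacobi_operator \<alpha> \<beta> p) x * poly q x - poly p x * poly (jacobi_operator \<alpha> \<beta> q) x)
            * jacobi_weight \<alpha> \<beta> x) (at x)"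
      unfolding G_def
      by (rule derivative_eq_intros d1 d2 dv refl)+
        (simp add: v_def pw poly_jacobi_operator jacobi_weight_def, simp add: algebra_simps power2_eq_square)
    then show "(G has_vector_derivative
        (poly (jacobi_operator \<alpha> \<beta> p) x * poly q x - poly p x * poly (jacobi_operator \<alpha> \<beta> q) x)
            * jacobi_weight \<alpha> \<beta> x) (at x)"
      by (simp add: has_real_derivative_iff_has_vector_derivative)
  qed simp
  then show ?thesis by (simp add: G_def)
qed

text \<open>Induction on \<open>k\<close>: subtracting a multiple of \<open>P k\<close> from
  \<open>q\<close> removes its top coefficient. Bounding coefficients instead of the degree lets
  \<open>k = 0\<close> mean the zero polynomial.\<close>

lemma jacobi_polynomials_orthogonal_lower_degree:
  assumes J: "jacobi_polynomials \<alpha> \<beta> P" and "k \<le> n" and "\<And>i. k \<le> i \<Longrightarrow> coeff q i = 0"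
  shows "((\<lambda>x. poly (P n) x * poly q x * jacobi_weight \<alpha> \<beta> x) has_integral 0) {-1..1}"
  using assms(2,3)
proof (induction k arbitrary: q)
  case 0
  then have "q = 0" by (simp add: poly_eq_iff)
  then show ?case by simp
next
  case (Suc k)
  define c where "c = coeff q k / lead_coeff (P k)"
  define r where "r = q - smult c (P k)"
  have deg: "degree (P k) = k" "P k \<noteq> 0" using J by (auto simp: jacobi_polynomials_def)
  then have lead: "lead_coeff (P k) \<noteq> 0" by (metis leading_coeff_0_iff)
  have "coeff r i = 0" if "k \<le> i" for i
  proof (cases "i = k")
    case True
    with lead deg show ?thesis by (simp add: r_def c_def)
  next
    case False
    with that Suc.prems(2)[of i] deg show ?thesis by (simp add: r_def coeff_eq_0)
  qed
  with Suc have "((\<lambda>x. poly (P n) x * poly r x * jacobi_weight \<alpha> \<beta> x) has_integral 0) {-1..1}"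
    by simp
  moreover have "((\<lambda>x. poly (P n) x * poly (P k) x * jacobi_weight \<alpha> \<beta> x) has_integral 0) {-1..1}"
    using J Suc.prems(1) by (simp add: jacobi_polynomials_def)
  ultimately have "((\<lambda>x. poly (P n) x * poly r x * jacobi_weight \<alpha> \<beta> x
      + c * (poly (P n) x * poly (P k) x * jacobi_weight \<alpha> \<beta> x)) has_integral 0 + c * 0) {-1..1}"
    by (intro has_integral_add has_integral_mult_right)
  then show ?case by (simp add: r_def algebra_simps)
qed

text \<open>The weight may be unbounded near the endpoints, but it is continuous and positive on
  [-1/2, 1/2]. There the nonnegative integrand must vanish, so \<open>r\<close> has infinitely many
  roots.\<close>

lemma poly_eq_0_if_jacobi_norm_eq_0:
  assumes "((\<lambda>x. poly r x * poly r x * jacobi_weight \<alpha> \<beta> x) has_integral 0) {-1..1}"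
  shows "r = 0"
proof -
  let ?f = "\<lambda>x. poly r x * poly r x * jacobi_weight \<alpha> \<beta> x"
  let ?I = "{-1/2..1/2::real}"
  have nonneg: "?f x \<ge> 0" for x by (simp add: jacobi_weight_def)
  have int: "?f integrable_on {-1..1}" using assms by blast
  then have intI: "?f integrable_on ?I" by (rule integrable_on_subinterval) auto
  have "integral ?I ?f \<le> integral {-1..1} ?f"
    using int intI nonneg by (intro integral_subset_le) auto
  also have "\<dots> = 0" using assms by (rule integral_unique)
  finally have "integral ?I ?f = 0"
    using Henstock_Kurzweil_Integration.integral_nonneg[OF intI nonneg] by linarith
  with intI have hi: "(?f has_integral 0) (cbox (-1/2) (1/2))"
    by (metis cbox_interval integrable_integral)
  have cont: "continuous_on (cbox (-1/2) (1/2)) ?f"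
    unfolding jacobi_weight_def by (intro continuous_intros) auto
  have "poly r x = 0" if "x \<in> ?I" for x
  proof -
    have "?f x = 0"
      by (rule has_integral_0_cbox_imp_0[OF cont _ hi]) (use nonneg that in auto)
    with that show ?thesis by (simp add: jacobi_weight_def)
  qed
  then have "?I \<subseteq> {x. poly r x = 0}" by auto
  moreover have "infinite ?I" by (simp add: infinite_Icc)
  ultimately show ?thesis using poly_roots_finite finite_subset by blast
qed

theorem jacobi_differential_equation:
  assumes "\<alpha> > -1" and "\<beta> > -1" and J: "jacobi_polynomials \<alpha> \<beta> P"
  shows "jacobi_operator \<alpha> \<beta> (P n) = smult (- (real n * (real n + \<alpha> + \<beta> + 1))) (P n)"
proof -
  let ?l = "real n * (real n + \<alpha> + \<beta> + 1)"
  let ?L = "jacobi_operator \<alpha> \<beta>"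
  \<comment> \<open>The leading terms of \<open>r\<close> cancel, and symmetry makes \<open>r\<close> orthogonal to itself.\<close>
  define r where "r = ?L (P n) + smult ?l (P n)"
  have deg: "degree (P n) = n" using J by (auto simp: jacobi_polynomials_def)
  have r0: "coeff r i = 0" if "n \<le> i" for i
    using that deg by (cases "i = n") (simp_all add: r_def coeff_jacobi_operator coeff_eq_0)
  \<comment> \<open>Symmetry moves the operator from \<open>P n\<close> to \<open>r\<close>: the
    integral of \<open>r * r\<close> becomes that of \<open>P n\<close> times this polynomial, whose
    degree is again below \<open>n\<close>.\<close>
  have "coeff (?L r + smult ?l r) i = 0" if "n \<le> i" for i
    using that r0 by (simp add: coeff_jacobi_operator)
  then have "((\<lambda>x. poly (P n) x * poly (?L r + smult ?l r) x * jacobi_weight \<alpha> \<beta> x) has_integral 0) {-1..1}"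
    by (rule jacobi_polynomials_orthogonal_lower_degree[OF J order_refl])
  from has_integral_add[OF jacobi_operator_symmetric[OF assms(1,2), of "P n" r] this]
  have "((\<lambda>x. poly r x * poly r x * jacobi_weight \<alpha> \<beta> x) has_integral 0) {-1..1}"
    by (simp add: r_def algebra_simps)
  then have "r = 0" by (rule poly_eq_0_if_jacobi_norm_eq_0)
  then show ?thesis by (simp add: r_def eq_neg_iff_add_eq_0)
qed

section \<open>Sturm comparison with sines\<close>

lemma continuous_nonvanishing_sign:
  fixes u :: "real \<Rightarrow> real"
  assumes S: "is_interval S" and "continuous_on S u" and nz: "\<And>t. t \<in> S \<Longrightarrow> u t \<noteq> 0"
  shows "(\<forall>t\<in>S. u t > 0) \<or> (\<forall>t\<in>S. u t < 0)"
proof (rule ccontr)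
  assume "\<not> ?thesis"
  with nz obtain s t where st: "s \<in> S" "t \<in> S" "u s < 0" "u t > 0" by force
  have "connected (u ` S)"
    using assms(1,2) by (simp add: connected_continuous_image is_interval_connected)
  then have "{u s..u t} \<subseteq> u ` S"
    using st by (intro connected_contains_Icc) auto
  then have "0 \<in> u ` S" using st by auto
  with nz show False by auto
qed

text \<open>The products of first derivatives cancel, and the two second-order equations leave the
  difference of their coefficients. The sign of this derivative drives both comparison
  lemmas.\<close>

lemma wronskian_sin_has_derivative:
  fixes u :: "real \<Rightarrow> real"
  assumes "(u has_real_derivative u' t) (at t)" and "(u' has_real_derivative - F * u t) (at t)"
  shows "((\<lambda>t. u' t * sin (w * (t - c)) - u t * (w * cos (w * (t - c)))) has_real_derivative
     (w\<^sup>2 - F) * (u t * sin (w * (t - c)))) (at t)"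
  by (rule derivative_eq_intros assms refl)+ (simp add: algebra_simps power2_eq_square)

text \<open>Over a half period of \<open>sin (w * (t - a))\<close> a positive solution would have a
  nonincreasing Wronskian, yet the Wronskian is negative at the left end and positive at the right
  end.\<close>

lemma Sturm_zero_exists:
  fixes u :: "real \<Rightarrow> real"
  assumes w: "w > 0"
    and u: "\<And>t. t \<in> {a..a + pi / w} \<Longrightarrow> (u has_real_derivative u' t) (at t)"
    and u': "\<And>t. t \<in> {a..a + pi / w} \<Longrightarrow> (u' has_real_derivative - F t * u t) (at t)"
    and F: "\<And>t. t \<in> {a..a + pi / w} \<Longrightarrow> w\<^sup>2 \<le> F t"
  shows "\<exists>t\<in>{a..a + pi / w}. u t = 0"
proof (rule ccontr)
  let ?I = "{a..a + pi / w}"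
  assume "\<not> ?thesis"
  then have nz: "\<And>t. t \<in> ?I \<Longrightarrow> u t \<noteq> 0" by blast
  \<comment> \<open>Stated for any positive solution \<open>y\<close>, so that linearity allows both
    \<open>u\<close> and \<open>- u\<close>.\<close>
  have contra: False
    if pos: "\<And>t. t \<in> ?I \<Longrightarrow> y t > 0"
      and y: "\<And>t. t \<in> ?I \<Longrightarrow> (y has_real_derivative y' t) (at t)"
      and y': "\<And>t. t \<in> ?I \<Longrightarrow> (y' has_real_derivative - F t * y t) (at t)"
    for y y' :: "real \<Rightarrow> real"
  proof -
    define W where "W = (\<lambda>t. y' t * sin (w * (t - a)) - y t * (w * cos (w * (t - a))))"
    have dW: "(W has_real_derivative (w\<^sup>2 - F t) * (y t * sin (w * (t - a)))) (at t)" if "t \<in> ?I" for t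
      unfolding W_def by (rule wronskian_sin_has_derivative[OF y[OF that] y'[OF that]])
    have ends: "a \<in> ?I" "a + pi / w \<in> ?I" using w by auto
    have "W (a + pi / w) \<le> W a"
    proof (rule DERIV_nonpos_imp_nonincreasing[where f = W])
      fix t assume "a \<le> t" "t \<le> a + pi / w"
      then have t: "t \<in> ?I" by simp
      have "w * (t - a) \<le> pi" using t w by (simp add: field_simps)
      then have "y t * sin (w * (t - a)) \<ge> 0"
        using t w pos[OF t] by (intro mult_nonneg_nonneg sin_ge_zero) auto
      then have "(w\<^sup>2 - F t) * (y t * sin (w * (t - a))) \<le> 0"
        using F[OF t] by (intro mult_nonpos_nonneg) auto
      with dW[OF t]
      show "\<exists>d. (W has_real_derivative d) (at t) \<and> d \<le> 0" by blast
    qed (use ends in auto)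
    \<comment> \<open>At the two ends the sine is 0 and the cosine is 1 and -1.\<close>
    then have "w * (y a + y (a + pi / w)) \<le> 0" using w by (simp add: W_def algebra_simps)
    moreover have "w * (y a + y (a + pi / w)) > 0"
      using w pos ends by (intro mult_pos_pos add_pos_pos) auto
    ultimately show False by simp
  qed
  have "continuous_on ?I u"
    using u by (meson DERIV_isCont continuous_at_imp_continuous_on)
  from continuous_nonvanishing_sign[OF is_interval_cc this nz]
  consider "\<And>t. t \<in> ?I \<Longrightarrow> u t > 0" | "\<And>t. t \<in> ?I \<Longrightarrow> u t < 0" by blast
  then show False
  proof cases
    case 1
    then show False using u u' by (rule contra)
  next
    case 2
    then show False
      using DERIV_minus[OF u] DERIV_minus[OF u'] by (intro contra[of "\<lambda>t. - u t" "\<lambda>t. - u' t"]) auto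
  qed
qed

text \<open>If the gap were shorter than a half period, some shifted sine would be positive on all
  of [a, b]. For a solution positive between its zeros the Wronskian then increases strictly,
  although the one-sided slopes at the zeros make it nonnegative at \<open>a\<close> and nonpositive
  at \<open>b\<close>.\<close>

lemma Sturm_zero_gap:
  fixes u :: "real \<Rightarrow> real"
  assumes "a < b" and w: "w > 0" and zeros: "u a = 0" "u b = 0"
    and nz: "\<And>t. t \<in> {a<..<b} \<Longrightarrow> u t \<noteq> 0"
    and u: "\<And>t. t \<in> {a..b} \<Longrightarrow> (u has_real_derivative u' t) (at t)"
    and u': "\<And>t. t \<in> {a..b} \<Longrightarrow> (u' has_real_derivative - F t * u t) (at t)"
    and F: "\<And>t. t \<in> {a..b} \<Longrightarrow> F t < w\<^sup>2"
  shows "pi / w \<le> b - a"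
proof (rule ccontr)
  assume "\<not> ?thesis"
  then have gap: "b - a < pi / w" by simp
  \<comment> \<open>Half of the slack goes to the left of \<open>a\<close>, so that the sine is positive on the closed interval.\<close>
  define c where "c = a - (pi / w - (b - a)) / 2"
  have sin_pos: "sin (w * (t - c)) > 0" if "t \<in> {a..b}" for t
  proof (rule sin_gt_zero)
    have t: "0 < t - c \<and> t - c < pi / w" using that gap unfolding c_def atLeastAtMost_iff by argo
    with w show "0 < w * (t - c)" by simp
    show "w * (t - c) < pi" using t w by (simp add: field_simps)
  qed
  have contra: False
    if pos: "\<And>t. t \<in> {a<..<b} \<Longrightarrow> y t > 0"
      and y: "\<And>t. t \<in> {a..b} \<Longrightarrow> (y has_real_derivative y' t) (at t)"
      and y': "\<And>t. t \<in> {a..b} \<Longrightarrow> (y' has_real_derivative - F t * y t) (at t)"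
      and y0: "y a = 0" "y b = 0"
    for y y' :: "real \<Rightarrow> real"
  proof -
    define W where "W = (\<lambda>t. y' t * sin (w * (t - c)) - y t * (w * cos (w * (t - c))))"
    have dW: "(W has_real_derivative (w\<^sup>2 - F t) * (y t * sin (w * (t - c)))) (at t)" if "t \<in> {a..b}" for t
      unfolding W_def by (rule wronskian_sin_has_derivative[OF y[OF that] y'[OF that]])
    have "W a < W b"
    proof (rule DERIV_pos_imp_increasing_open[where f = W, OF \<open>a < b\<close>])
      show "continuous_on {a..b} W"
        using dW by (meson DERIV_isCont continuous_at_imp_continuous_on)
      fix t assume "a < t" "t < b"
      then have t: "t \<in> {a..b}" "t \<in> {a<..<b}" by auto
      have "(w\<^sup>2 - F t) * (y t * sin (w * (t - c))) > 0"
        using F[OF t(1)] pos[OF t(2)] sin_pos[OF t(1)] by simp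
      with dW[OF t(1)] show "\<exists>d. (W has_real_derivative d) (at t) \<and> 0 < d" by blast
    qed
    \<comment> \<open>A negative slope would push \<open>y\<close> below \<open>y a = 0\<close>
      immediately to the right of \<open>a\<close>; the end \<open>b\<close> is the mirror
      image.\<close>
    moreover have "y' a \<ge> 0"
    proof (rule ccontr)
      assume "\<not> ?thesis"
      then obtain d where d: "d > 0" "\<And>h. 0 < h \<Longrightarrow> h < d \<Longrightarrow> y (a + h) < y a"
        using DERIV_neg_dec_right[OF y[of a]] \<open>a < b\<close> by auto
      let ?h = "min d (b - a) / 2"
      have "0 < ?h" "?h < d" "a + ?h \<in> {a<..<b}" using d(1) \<open>a < b\<close> by (auto simp: min_def field_simps)
      then show False using d(2)[of ?h] pos[of "a + ?h"] y0 by simp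
    qed
    moreover have "y' b \<le> 0"
    proof (rule ccontr)
      assume "\<not> ?thesis"
      then obtain d where d: "d > 0" "\<And>h. 0 < h \<Longrightarrow> h < d \<Longrightarrow> y (b - h) < y b"
        using DERIV_pos_inc_left[OF y[of b]] \<open>a < b\<close> by auto
      let ?h = "min d (b - a) / 2"
      have "0 < ?h" "?h < d" "b - ?h \<in> {a<..<b}" using d(1) \<open>a < b\<close> by (auto simp: min_def field_simps)
      then show False using d(2)[of ?h] pos[of "b - ?h"] y0 by simp
    qed
    moreover have "sin (w * (a - c)) \<ge> 0" "sin (w * (b - c)) \<ge> 0"
      using sin_pos[of a] sin_pos[of b] \<open>a < b\<close> by simp_all
    ultimately have "W a < W b" "y' a * sin (w * (a - c)) \<ge> 0" "y' b * sin (w * (b - c)) \<le> 0"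
      by (simp_all only: mult_nonneg_nonneg mult_nonpos_nonneg)
    then show False unfolding W_def y0 by linarith
  qed
  have "continuous_on {a<..<b} u"
    using DERIV_isCont[OF u] by (intro continuous_at_imp_continuous_on) auto
  from continuous_nonvanishing_sign[OF is_interval_oo this nz]
  consider "\<And>t. t \<in> {a<..<b} \<Longrightarrow> u t > 0" | "\<And>t. t \<in> {a<..<b} \<Longrightarrow> u t < 0" by blast
  then show False
  proof cases
    case 1
    then show False using u u' zeros by (rule contra)
  next
    case 2
    then show False
      using DERIV_minus[OF u] DERIV_minus[OF u'] zeros by (intro contra[of "\<lambda>t. - u t" "\<lambda>t. - u' t"]) auto
  qed
qed

section \<open>Liouville normal form of the Jacobi equation\<close>

text \<open>
  For \<open>y t = poly p (cos t)\<close> the eigenvalue equation reads \<open>y'' + h y' + l y = 0\<close> with \<open>h\<close> the friction.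
  The potential is \<open>h' / 2 + h\<^sup>2 / 4\<close>. The Liouville factor \<open>g\<close> solves \<open>g' = g h / 2\<close>; up to a constant
  it is \<open>sin (t/2) powr (\<alpha> + 1/2) * cos (t/2) powr (\<beta> + 1/2)\<close>.
\<close>

definition jacobi_friction :: "real \<Rightarrow> real \<Rightarrow> real \<Rightarrow> real" where
  "jacobi_friction \<alpha> \<beta> t = (\<alpha> - \<beta> + (\<alpha> + \<beta> + 1) * cos t) / sin t"

definition jacobi_potential :: "real \<Rightarrow> real \<Rightarrow> real \<Rightarrow> real" where
  "jacobi_potential \<alpha> \<beta> t = (jacobi_friction \<alpha> \<beta> t)\<^sup>2 / 4 -
     ((\<alpha> + \<beta> + 1) * (sin t)\<^sup>2 + (\<alpha> - \<beta> + (\<alpha> + \<beta> + 1) * cos t) * cos t) / (2 * (sin t)\<^sup>2)"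

definition liouville_factor :: "real \<Rightarrow> real \<Rightarrow> real \<Rightarrow> real" where
  "liouville_factor \<alpha> \<beta> t = exp (((\<alpha> + 1/2) * ln (1 - cos t) + (\<beta> + 1/2) * ln (1 + cos t)) / 2)"

lemma abs_cos_less_1:
  fixes t :: real
  assumes "0 < t" "t < pi"
  shows "\<bar>cos t\<bar> < 1"
  using cos_monotone_0_pi[of 0 t] cos_monotone_0_pi[of t pi] assms by (simp add: abs_less_iff)

text \<open>Since \<open>sin t * sin t = (1 - cos t) * (1 + cos t)\<close>, both fractions in the
  logarithmic derivative can be rewritten with denominator \<open>sin t\<close>, where they combine
  to half the friction.\<close>

lemma liouville_factor_has_derivative:
  assumes "0 < t" "t < pi"
  shows "(liouville_factor \<alpha> \<beta> has_real_derivative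
           liouville_factor \<alpha> \<beta> t * (jacobi_friction \<alpha> \<beta> t / 2)) (at t)"
proof -
  have cos: "1 - cos t > 0" "1 + cos t > 0" using abs_cos_less_1[OF assms] by auto
  have s: "sin t > 0" using assms by (rule sin_gt_zero)
  have sc: "sin t * sin t = (1 - cos t) * (1 + cos t)"
    using sin_squared_eq[of t] by (simp add: algebra_simps power2_eq_square)
  have 1: "sin t / (1 - cos t) = (1 + cos t) / sin t" "sin t / (1 + cos t) = (1 - cos t) / sin t"
    using cos s sc by (simp_all add: frac_eq_eq mult.commute)
  have "(\<alpha> + 1/2) * (sin t / (1 - cos t)) - (\<beta> + 1/2) * (sin t / (1 + cos t)) = jacobi_friction \<alpha> \<beta> t"
    unfolding 1 using s by (simp add: jacobi_friction_def field_simps)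
  then have e: "((\<alpha> + 1/2) * (sin t / (1 - cos t)) + (\<beta> + 1/2) * (- sin t / (1 + cos t))) / 2
      = jacobi_friction \<alpha> \<beta> t / 2" by simp
  show ?thesis
    unfolding liouville_factor_def[abs_def] e[symmetric] using cos
    by (auto intro!: derivative_eq_intros simp: mult_ac)
qed

lemma jacobi_friction_has_derivative:
  assumes "0 < t" "t < pi"
  shows "(jacobi_friction \<alpha> \<beta> has_real_derivative
           2 * jacobi_potential \<alpha> \<beta> t - (jacobi_friction \<alpha> \<beta> t)\<^sup>2 / 2) (at t)"
proof -
  have s: "sin t \<noteq> 0" using sin_gt_zero[OF assms] by simp
  show ?thesis
    unfolding jacobi_friction_def[abs_def]
    by (rule derivative_eq_intros refl s)+
      (use s in \<open>simp add: jacobi_potential_def jacobi_friction_def power2_eq_square field_simps\<close>)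
qed

lemma jacobi_potential_bounded:
  assumes "\<delta> > 0"
  obtains C where "C > 0" and "\<And>t. t \<in> {\<delta>..pi - \<delta>} \<Longrightarrow> \<bar>jacobi_potential \<alpha> \<beta> t\<bar> \<le> C"
proof -
  have "sin t \<noteq> 0" if "t \<in> {\<delta>..pi - \<delta>}" for t
    using sin_gt_zero[of t] that assms by auto
  then have "continuous_on {\<delta>..pi - \<delta>} (jacobi_potential \<alpha> \<beta>)"
    unfolding jacobi_potential_def[abs_def] jacobi_friction_def[abs_def]
    by (intro continuous_intros) auto
  then have "bounded (jacobi_potential \<alpha> \<beta> ` {\<delta>..pi - \<delta>})"
    by (intro compact_imp_bounded compact_continuous_image) auto
  then show ?thesis using that by (auto simp: bounded_pos)
qed

text \<open>For \<open>u = g y\<close>, the relation \<open>g' = g h / 2\<close> gives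
  \<open>u'' = g (y'' + h y' + (h' / 2 + h^2 / 4) y)\<close>; the first two terms amount to
  \<open>- l y\<close>, the last to the potential times \<open>y\<close>.\<close>

lemma jacobi_liouville_normal_form:
  assumes ode: "jacobi_operator \<alpha> \<beta> p = smult (- l) p" and t: "0 < t" "t < pi"
  defines "g \<equiv> liouville_factor \<alpha> \<beta>" and "h \<equiv> jacobi_friction \<alpha> \<beta>"
  shows "((\<lambda>t. g t * poly p (cos t)) has_real_derivative
           g t * (h t / 2 * poly p (cos t) - sin t * poly (pderiv p) (cos t))) (at t)"
    and "((\<lambda>t. g t * (h t / 2 * poly p (cos t) - sin t * poly (pderiv p) (cos t))) has_real_derivative
           - (l - jacobi_potential \<alpha> \<beta> t) * (g t * poly p (cos t))) (at t)"
proof -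
  note dg = liouville_factor_has_derivative[OF t, of \<alpha> \<beta>, folded g_def h_def]
  note dh = jacobi_friction_has_derivative[OF t, of \<alpha> \<beta>, folded h_def]
  have dp: "((\<lambda>t. poly q (cos t)) has_real_derivative - sin t * poly (pderiv q) (cos t)) (at t)" for q
    using DERIV_chain[OF poly_DERIV DERIV_cos, of q t] by (simp add: o_def mult.commute)
  show "((\<lambda>t. g t * poly p (cos t)) has_real_derivative
           g t * (h t / 2 * poly p (cos t) - sin t * poly (pderiv p) (cos t))) (at t)"
    by (rule derivative_eq_intros dg dp refl)+ (simp add: algebra_simps)
  have s: "sin t \<noteq> 0" using sin_gt_zero[OF t] by simp
  have hs: "h t * sin t = \<alpha> - \<beta> + (\<alpha> + \<beta> + 1) * cos t"
    using s by (simp add: h_def jacobi_friction_def)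
  have sin_mult_sin: "sin t * sin t = 1 - cos t * cos t"
    using sin_squared_eq[of t] by (simp add: power2_eq_square)
  have "poly (jacobi_operator \<alpha> \<beta> p) (cos t) = - l * poly p (cos t)" by (simp add: ode)
  \<comment> \<open>At \<open>x = cos t\<close> the first-order coefficient of the operator is
    \<open>- (h t * sin t + cos t)\<close>.\<close>
  then have p2: "sin t * sin t * poly (pderiv (pderiv p)) (cos t)
      = (h t * sin t + cos t) * poly (pderiv p) (cos t) - l * poly p (cos t)"
    unfolding poly_jacobi_operator hs sin_mult_sin by (simp add: power2_eq_square algebra_simps)
  \<comment> \<open>The left side is the derivative as the product rule delivers it; inserting
    \<open>p2\<close> cancels all terms in \<open>pderiv p\<close>.\<close>
  have e: "g t * (h t / 2) * (h t / 2 * poly p (cos t) - sin t * poly (pderiv p) (cos t))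
      + g t * ((2 * jacobi_potential \<alpha> \<beta> t - (h t)\<^sup>2 / 2) / 2 * poly p (cos t)
          + h t / 2 * (- sin t * poly (pderiv p) (cos t))
          - (cos t * poly (pderiv p) (cos t) - sin t * sin t * poly (pderiv (pderiv p)) (cos t)))
      = - (l - jacobi_potential \<alpha> \<beta> t) * (g t * poly p (cos t))"
    unfolding p2 by (simp add: field_simps power2_eq_square)
  show "((\<lambda>t. g t * (h t / 2 * poly p (cos t) - sin t * poly (pderiv p) (cos t))) has_real_derivative
           - (l - jacobi_potential \<alpha> \<beta> t) * (g t * poly p (cos t))) (at t)"
    unfolding e[symmetric]
    using DERIV_mult[OF dg DERIV_diff[OF DERIV_mult[OF DERIV_cdivide[OF dh, of 2] dp[of p]]
      DERIV_mult[OF DERIV_sin dp[of "pderiv p"]]]]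
    by (simp add: algebra_simps)
qed

section \<open>Existence and spacing of zeros in the interior\<close>

lemma jacobi_zero_exists:
  assumes ode: "jacobi_operator \<alpha> \<beta> p = smult (- l) p" and "\<delta> > 0"
    and C: "\<And>t. t \<in> {\<delta>..pi - \<delta>} \<Longrightarrow> \<bar>jacobi_potential \<alpha> \<beta> t\<bar> < C" and "C < l"
    and ab: "\<delta> \<le> a" "a + pi / sqrt (l - C) \<le> pi - \<delta>"
  shows "\<exists>t\<in>{a..a + pi / sqrt (l - C)}. poly p (cos t) = 0"
proof -
  let ?w = "sqrt (l - C)"
  have "\<exists>t\<in>{a..a + pi / ?w}. liouville_factor \<alpha> \<beta> t * poly p (cos t) = 0"
  proof (rule Sturm_zero_exists)
    show "?w > 0" using \<open>C < l\<close> by simp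
    fix t assume t: "t \<in> {a..a + pi / ?w}"
    then have "0 < t" "t < pi" using ab \<open>\<delta> > 0\<close> by auto
    note jacobi_liouville_normal_form[OF ode this]
    then show "((\<lambda>t. liouville_factor \<alpha> \<beta> t * poly p (cos t)) has_real_derivative
        liouville_factor \<alpha> \<beta> t * (jacobi_friction \<alpha> \<beta> t / 2 * poly p (cos t)
          - sin t * poly (pderiv p) (cos t))) (at t)"
      and "((\<lambda>t. liouville_factor \<alpha> \<beta> t * (jacobi_friction \<alpha> \<beta> t / 2 * poly p (cos t)
          - sin t * poly (pderiv p) (cos t))) has_real_derivative
        - (l - jacobi_potential \<alpha> \<beta> t) * (liouville_factor \<alpha> \<beta> t * poly p (cos t))) (at t)"
      by blast+
    show "?w\<^sup>2 \<le> l - jacobi_potential \<alpha> \<beta> t"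
      using C[of t] t ab \<open>C < l\<close> by auto
  qed
  \<comment> \<open>The Liouville factor is an exponential, hence never zero.\<close>
  then show ?thesis by (simp add: liouville_factor_def)
qed

lemma jacobi_zero_gap:
  assumes ode: "jacobi_operator \<alpha> \<beta> p = smult (- l) p" and "\<delta> > 0"
    and C: "\<And>t. t \<in> {\<delta>..pi - \<delta>} \<Longrightarrow> \<bar>jacobi_potential \<alpha> \<beta> t\<bar> < C" and "l + C > 0"
    and ab: "\<delta> \<le> a" "a < b" "b \<le> pi - \<delta>"
    and zeros: "poly p (cos a) = 0" "poly p (cos b) = 0"
    and nz: "\<And>t. t \<in> {a<..<b} \<Longrightarrow> poly p (cos t) \<noteq> 0"
  shows "pi / sqrt (l + C) \<le> b - a"
proof (rule Sturm_zero_gap[where u = "\<lambda>t. liouville_factor \<alpha> \<beta> t * poly p (cos t)"])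
  fix t assume t: "t \<in> {a..b}"
  then have "0 < t" "t < pi" using ab \<open>\<delta> > 0\<close> by auto
  note jacobi_liouville_normal_form[OF ode this]
  then show "((\<lambda>t. liouville_factor \<alpha> \<beta> t * poly p (cos t)) has_real_derivative
      liouville_factor \<alpha> \<beta> t * (jacobi_friction \<alpha> \<beta> t / 2 * poly p (cos t)
        - sin t * poly (pderiv p) (cos t))) (at t)"
    and "((\<lambda>t. liouville_factor \<alpha> \<beta> t * (jacobi_friction \<alpha> \<beta> t / 2 * poly p (cos t)
        - sin t * poly (pderiv p) (cos t))) has_real_derivative
      - (l - jacobi_potential \<alpha> \<beta> t) * (liouville_factor \<alpha> \<beta> t * poly p (cos t))) (at t)"
    by blast+
  show "l - jacobi_potential \<alpha> \<beta> t < (sqrt (l + C))\<^sup>2"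
    using C[of t] t ab \<open>l + C > 0\<close> by auto
qed (use ab zeros nz \<open>l + C > 0\<close> in \<open>auto simp: liouville_factor_def\<close>)

section \<open>Asymptotics of the gaps\<close>

theorem theorem7p1:
  fixes \<alpha> \<beta> :: real and P :: "nat \<Rightarrow> real poly" and \<theta> :: "nat \<Rightarrow> nat \<Rightarrow> real"
  assumes "\<alpha> > -1" and "\<beta> > -1"
    and "jacobi_polynomials \<alpha> \<beta> P"
    and "\<And>n j. j \<in> {1..n} \<Longrightarrow> 0 < \<theta> n j \<and> \<theta> n j < pi"
    and "\<And>n. strict_mono_on {1..n} (\<theta> n)"
    and "\<And>n. (\<lambda>j. cos (\<theta> n j)) ` {1..n} = {x. poly (P n) x = 0}"
  shows "\<forall>\<epsilon>>0. (\<lambda>n. SUP j\<in>{j \<in> {1..n}. \<theta> n j \<in> {\<epsilon>..pi - \<epsilon>}}.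
           ennreal (real n * \<bar>\<theta> n (j + 1) - \<theta> n j - pi / real n\<bar>)) \<longlonglongrightarrow> 0"
proof (intro allI impI)
  fix \<epsilon> :: real assume "\<epsilon> > 0"
  \<comment> \<open>The margin leaves room for the zero following one in
    [\<epsilon>, pi - \<epsilon>]: a gap of at most \<delta> keeps it in
    [\<delta>, pi - \<delta>].\<close>
  define \<delta> where "\<delta> = \<epsilon> / 2"
  have \<delta>: "\<delta> > 0" "\<epsilon> = 2 * \<delta>" using \<open>\<epsilon> > 0\<close> by (simp_all add: \<delta>_def)
  obtain C' where "C' > 0" "\<And>t. t \<in> {\<delta>..pi - \<delta>} \<Longrightarrow> \<bar>jacobi_potential \<alpha> \<beta> t\<bar> \<le> C'"
    using jacobi_potential_bounded[OF \<delta>(1)] by metis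
  \<comment> \<open>Enlarging the bound by 1 makes it strict, as \<open>jacobi_zero_gap\<close>
    requires.\<close>
  then obtain C where C: "C > 0" "\<And>t. t \<in> {\<delta>..pi - \<delta>} \<Longrightarrow> \<bar>jacobi_potential \<alpha> \<beta> t\<bar> < C"
    using that[of "C' + 1"] by force
  define l where "l n = real n * (real n + \<alpha> + \<beta> + 1)" for n
  \<comment> \<open>The names refer to frequencies: the low one yields the upper bound
    \<open>lo n\<close> for the gap, the high one the lower bound \<open>hi n\<close>.\<close>
  define lo where "lo n = pi / sqrt (l n - C)" for n
  define hi where "hi n = pi / sqrt (l n + C)" for n
  define e where "e n = max (real n * lo n - pi) (pi - real n * hi n)" for n
  have ode: "jacobi_operator \<alpha> \<beta> (P n) = smult (- l n) (P n)" for n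
    unfolding l_def by (rule jacobi_differential_equation[OF assms(1-3)])
  have \<theta>_less_iff: "\<theta> n i < \<theta> n k \<longleftrightarrow> i < k" if "i \<in> {1..n}" "k \<in> {1..n}" for n i k
    using strict_mono_onD[OF assms(5)] that by (metis linorder_neq_iff order_less_asym)
  have zero_index: "\<exists>k\<in>{1..n}. t = \<theta> n k" if "poly (P n) (cos t) = 0" "0 < t" "t < pi" for n t
  proof -
    have "cos t \<in> (\<lambda>j. cos (\<theta> n j)) ` {1..n}" using that(1) assms(6) by simp
    then obtain k where k: "k \<in> {1..n}" "cos t = cos (\<theta> n k)" by blast
    with assms(4)[OF k(1)] that(2,3) have "t = \<theta> n k" by (simp add: cos_inj_pi)
    with k show ?thesis by blast
  qed
  have bound: "real n * \<bar>\<theta> n (j + 1) - \<theta> n j - pi / real n\<bar> \<le> e n"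
    if n: "n > 0" "l n > C" "lo n < \<delta>" and j: "j \<in> {1..n}" "\<theta> n j \<in> {\<epsilon>..pi - \<epsilon>}" for n j
  proof -
    let ?a = "\<theta> n j" and ?b = "\<theta> n (j + 1)"
    \<comment> \<open>The window of length \<open>lo n\<close> ends at \<open>?a + s\<close>. Since
      \<open>s > lo n\<close>, it starts strictly to the right of \<open>?a\<close>, so the zero
      found there is not \<open>?a\<close> itself.\<close>
    have next_zero: "\<exists>k\<in>{1..n}. j < k \<and> \<theta> n k \<le> ?a + s" if s: "lo n < s" "s \<le> \<delta>" for s
    proof -
      have "\<exists>t\<in>{?a + (s - lo n)..?a + (s - lo n) + lo n}. poly (P n) (cos t) = 0"
        unfolding lo_def using n j s \<delta> unfolding lo_def
        by (intro jacobi_zero_exists[OF ode \<delta>(1) C(2)]) auto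
      then obtain t where "t \<in> {?a + (s - lo n)..?a + s}" and z: "poly (P n) (cos t) = 0" by auto
      with s have t: "?a < t" "t \<le> ?a + s" by auto
      then obtain k where k: "k \<in> {1..n}" "t = \<theta> n k"
        using zero_index[OF z] j s \<delta> by auto
      with t \<theta>_less_iff[OF j(1)] show ?thesis by auto
    qed
    \<comment> \<open>\<open>\<theta> n (n + 1)\<close> is unconstrained, so \<open>j = n\<close> has to be excluded here.\<close>
    have j1: "j + 1 \<in> {1..n}" using next_zero[of \<delta>] n by auto
    have b_le: "?b \<le> ?a + s" if s: "lo n < s" "s \<le> \<delta>" for s
    proof -
      obtain k where k: "k \<in> {1..n}" "j < k" "\<theta> n k \<le> ?a + s" using next_zero[OF s] by blast
      then have "?b \<le> \<theta> n k" using \<theta>_less_iff[OF k(1) j1] by auto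
      with k show ?thesis by simp
    qed
    \<comment> \<open>Let \<open>s\<close> decrease to \<open>lo n\<close>.\<close>
    have "?b - ?a \<le> lo n"
      using b_le n(3) by (intro dense_ge_bounded[of "lo n" \<delta>]) (auto simp: algebra_simps)
    then have upper: "real n * (?b - ?a) \<le> real n * lo n" by (intro mult_left_mono) auto
    have ab: "?a < ?b" using \<theta>_less_iff[OF j(1) j1] by simp
    have "hi n \<le> ?b - ?a"
      unfolding hi_def
    proof (rule jacobi_zero_gap[OF ode \<delta>(1) C(2)])
      show "poly (P n) (cos ?a) = 0" "poly (P n) (cos ?b) = 0"
        using assms(6)[of n] j(1) j1 by auto
      show "?b \<le> pi - \<delta>" using b_le[of \<delta>] n(3) j(2) \<delta> by simp
      \<comment> \<open>A zero in between would have an index strictly between \<open>j\<close> and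
        \<open>j + 1\<close>.\<close>
      then show "poly (P n) (cos t) \<noteq> 0" if "t \<in> {?a<..<?b}" for t
        using that zero_index[of n t] \<theta>_less_iff[OF j(1)] \<theta>_less_iff[OF _ j1] j(2) \<delta> by fastforce
    qed (use ab j(2) \<delta> n C in auto)
    then have lower: "real n * hi n \<le> real n * (?b - ?a)" by (intro mult_left_mono) auto
    have "real n * \<bar>?b - ?a - pi / real n\<bar> = \<bar>real n * (?b - ?a - pi / real n)\<bar>"
      by (simp add: abs_mult)
    also have "real n * (?b - ?a - pi / real n) = real n * (?b - ?a) - pi"
      using n(1) by (simp add: right_diff_distrib)
    finally show ?thesis using upper lower by (simp add: e_def)
  qed
  \<comment> \<open>Both square roots are asymptotic to \<open>n\<close>, because \<open>l n\<close>
    is \<open>n^2\<close> plus a term linear in \<open>n\<close>.\<close>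
  have lim_lo: "(\<lambda>n. real n * lo n) \<longlonglongrightarrow> pi" and lim_hi: "(\<lambda>n. real n * hi n) \<longlonglongrightarrow> pi"
    and "lo \<longlonglongrightarrow> 0" and "filterlim l at_top sequentially"
    unfolding lo_def hi_def l_def by real_asymp+
  from order_tendstoD(2)[OF this(3) \<delta>(1)] this(4)
  have "\<forall>\<^sub>F n in sequentially. n > 0 \<and> l n > C \<and> lo n < \<delta>"
    by (intro eventually_conj eventually_gt_at_top) (simp_all add: filterlim_at_top_dense)
  \<comment> \<open>An empty index set is covered too: its supremum in \<open>ennreal\<close> is
    0.\<close>
  then have le: "\<forall>\<^sub>F n in sequentially. (SUP j\<in>{j \<in> {1..n}. \<theta> n j \<in> {\<epsilon>..pi - \<epsilon>}}.
      ennreal (real n * \<bar>\<theta> n (j + 1) - \<theta> n j - pi / real n\<bar>)) \<le> ennreal (e n)"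
    by eventually_elim (intro SUP_least ennreal_leI bound, auto)
  have "e \<longlonglongrightarrow> max (pi - pi) (pi - pi)"
    unfolding e_def by (intro tendsto_max tendsto_diff tendsto_const lim_lo lim_hi)
  then have "(\<lambda>n. ennreal (e n)) \<longlonglongrightarrow> ennreal 0" by (intro tendsto_ennrealI) simp
  then show "(\<lambda>n. SUP j\<in>{j \<in> {1..n}. \<theta> n j \<in> {\<epsilon>..pi - \<epsilon>}}.
      ennreal (real n * \<bar>\<theta> n (j + 1) - \<theta> n j - pi / real n\<bar>)) \<longlonglongrightarrow> 0"
    by (intro tendsto_sandwich[OF _ le tendsto_const]) auto
qed

end
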